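(* Let $n=4$ and let $\mathbf c=\{c_i^{kj}\}$ be a real parameter collection such that: (1) for all $i\ne j$ in $\{1,2,3,4\}$, with $k$ and $l$ the remaining two elements of $\{1,2,3,4\}\setminus\{i,j\}$, $$c_j^{ik}c_i^{jl}\ne c_j^{il}c_i^{jk};$$ (2) the four inequalities $$c_2^{14}c_4^{13}c_3^{12}\ne c_4^{12}c_3^{14}c_2^{13},\qquad c_4^{21}c_3^{24}c_1^{23}\ne c_1^{24}c_4^{23}c_3^{21},$$ $$c_4^{31}c_2^{34}c_1^{32}\ne c_1^{34}c_4^{32}c_2^{31},\qquad c_2^{41}c_1^{43}c_3^{42}\ne c_1^{42}c_3^{41}c_2^{43}$$ hold. Then there exists a constant $T>0$ (depending on $\mathbf c$) such that for all $t\in(0,T)$ the characteristic variety $\Sigma(t\mathbf c)$ is smooth.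
   Context: A parameter collection (for general $n$; here $n=4$) is a family of real numbers $\mathbf c=\{c_i^{kj}\}$, with $i,j,k\in\{1,\dots,n\}$, $k\ne j$, satisfying $c_i^{kj}=c_i^{jk}$ (the index $i$ may coincide with $j$ or $k$). For real $t$ write $t\mathbf c=\{tc_i^{kj}\}_{k\neq j}$. For $\xi=(\xi_1,\dots,\xi_n)\in\mathbb R^n$ the principal symbol is the $n\times n$ matrix $P(\xi,\mathbf c)=(p_{ij})$ with $$p_{ii}=\xi_i+\sum_{k\ne i}c_i^{ki}\xi_k,\qquad p_{ij}=\sum_{k\ne j}c_i^{kj}\xi_k\quad (i\ne j).$$ The characteristic variety is $\Sigma(\mathbf c)=\{\xi\in\mathbb R^n\setminus\{0\}: \det P(\xi,\mathbf c)=0\}$. Its singular part is $\Sigma_{\rm sing}(\mathbf c)=\{\xi\in\mathbb R^n\setminus\{0\}: \operatorname{rank}P(\xi,\mathbf c)\le n-2\}$ (the points where all $(n-1)\times(n-1)$ minor determinants of $P(\xi,\mathbf c)$ vanish), and $\Sigma(\mathbf c)$ is called smooth if $\Sigma_{\rm sing}(\mathbf c)=\emptyset$. *)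

theory Defs
  imports "HOL-Analysis.Analysis"
begin

text \<open>
  The parameter \<open>c\<^sub>i\<^sup>k\<^sup>j\<close> is written \<open>c i k j\<close> (lower index first). Only the values with
  \<open>k \<noteq> j\<close> are part of a parameter collection; the values \<open>c i k k\<close> are unconstrained
  and never used below. For \<open>n = 4\<close> the index type is the numeral type \<^typ>\<open>4\<close>, whose four
  distinct elements are \<open>1, 2, 3, 4\<close> (with \<open>4 = 0\<close>; see \<open>UNIV_4\<close>).
\<close>

type_synonym 'n params = "'n \<Rightarrow> 'n \<Rightarrow> 'n \<Rightarrow> real"

definition parameter_collection :: "'n params \<Rightarrow> bool" where
  "parameter_collection c \<longleftrightarrow> (\<forall>i j k. k \<noteq> j \<longrightarrow> c i k j = c i j k)"

definition scale_params :: "real \<Rightarrow> 'n params \<Rightarrow> 'n params" where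
  "scale_params t c = (\<lambda>i k j. t * c i k j)"

definition principal_symbol :: "real ^ 'n \<Rightarrow> 'n::finite params \<Rightarrow> real ^ 'n ^ 'n" where
  "principal_symbol \<xi> c =
     (\<chi> i j. if i = j then \<xi> $ i + (\<Sum>k\<in>UNIV - {i}. c i k i * \<xi> $ k)
             else (\<Sum>k\<in>UNIV - {j}. c i k j * \<xi> $ k))"

definition char_variety :: "'n::finite params \<Rightarrow> (real ^ 'n) set" where
  "char_variety c = {\<xi> \<in> UNIV - {0}. det (principal_symbol \<xi> c) = 0}"

text \<open>The bound \<open>rank \<le> n - 2\<close> is stated additively because subtraction on \<^typ>\<open>nat\<close> truncates.\<close>

definition sing_char_variety :: "'n::finite params \<Rightarrow> (real ^ 'n) set" where
  "sing_char_variety c = {\<xi> \<in> UNIV - {0}. rank (principal_symbol \<xi> c) + 2 \<le> CARD('n)}"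

definition smooth_char_variety :: "'n::finite params \<Rightarrow> bool" where
  "smooth_char_variety c \<longleftrightarrow> sing_char_variety c = {}"

lemma sing_char_variety_subset: "sing_char_variety c \<subseteq> char_variety c"
proof
  fix \<xi> assume \<xi>: "\<xi> \<in> sing_char_variety c"
  then have "rank (principal_symbol \<xi> c) < CARD('a)"
    by (simp add: sing_char_variety_def)
  then have "det (principal_symbol \<xi> c) = 0"
    by (simp add: det_eq_0_rank)
  with \<xi> show "\<xi> \<in> char_variety c"
    by (simp add: sing_char_variety_def char_variety_def)
qed

end

theory Submission
  imports Defs
begin

text \<open>
  Write \<open>P(\<xi>, t c) = diag(\<xi>) + t M(\<xi>)\<close>, where \<open>M(\<xi>)\<close> is linear in \<open>\<xi>\<close> and independent of
  \<open>t\<close>. For small \<open>t\<close> a point of the unit sphere at which the rank drops to \<open>2\<close> must lie close to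
  a degenerate point of \<open>diag(\<xi>)\<close>, that is, to a coordinate plane or a coordinate axis. The first
  order term \<open>t M(\<xi>)\<close> decides whether such a drop occurs there, and the two groups of inequalities
  ensure that it does not: the first group excludes the coordinate planes, the second the axes.

  The proof makes this precise by compactness. If no \<open>T\<close> exists, there are \<open>t\<^sub>n \<rightarrow> 0\<close> and unit
  vectors \<open>\<xi>\<^sub>n \<rightarrow> x\<close> such that \<open>P(\<xi>\<^sub>n, t\<^sub>n c)\<close> has rank at most \<open>2\<close>
  (\<open>degenerate_sequence\<close>). All \<open>3 \<times> 3\<close> minors of these matrices vanish (\<open>minor3_eq_0\<close>). Dividing
  suitable combinations of them by the power of \<open>t\<^sub>n\<close> they contain and passing to the limit gives,
  for distinct indices \<open>i, j, k, l\<close>,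

  \<^item> \<open>x\<^sub>i x\<^sub>j x\<^sub>k = 0\<close> (\<open>limit_coordinates\<close>);
  \<^item> \<open>M\<^sub>i\<^sub>j(x) x\<^sub>k x\<^sub>l = 0\<close> (\<open>limit_two_directions\<close>);
  \<^item> \<open>M\<^sub>i\<^sub>j M\<^sub>j\<^sub>k M\<^sub>k\<^sub>i = M\<^sub>i\<^sub>k M\<^sub>j\<^sub>i M\<^sub>k\<^sub>j\<close> at \<open>x\<close> whenever \<open>x\<^sub>l \<noteq> 0\<close> (\<open>limit_one_direction\<close>).

  If \<open>x\<^sub>k\<close> and \<open>x\<^sub>l\<close> are both nonzero, then \<open>x\<^sub>i = x\<^sub>j = 0\<close>, and \<open>M\<^sub>i\<^sub>j(x) = M\<^sub>j\<^sub>i(x) = 0\<close> is a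
  homogeneous \<open>2 \<times> 2\<close> system for \<open>(x\<^sub>k, x\<^sub>l)\<close> whose determinant is nonzero by the first group of
  inequalities. So \<open>x\<close> lies on one axis \<open>l\<close>, where \<open>M\<^sub>i\<^sub>j(x) = c\<^sub>i\<^sup>l\<^sup>j x\<^sub>l\<close>, and the cyclic identity
  contradicts the inequality of the second group that belongs to \<open>l\<close>.
\<close>

section \<open>Minors and rank\<close>

text \<open>
  Selecting rows and columns amounts to multiplying by 0-1 matrices on both sides, which cannot
  raise the rank.
\<close>

lemma det_submatrix_eq_0:
  fixes A :: "real ^ 'n ^ 'n" and r s :: "'m::finite \<Rightarrow> 'n::finite"
  assumes "rank A < CARD('m)"
  shows "det (\<chi> a b. A $ r a $ s b) = 0"
proof -
  define R :: "real ^ 'n ^ 'm" where "R = (\<chi> a i. if i = r a then 1 else 0)"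
  define S :: "real ^ 'm ^ 'n" where "S = (\<chi> i b. if i = s b then 1 else 0)"
  have "(\<chi> a b. A $ r a $ s b) = R ** A ** S"
    by (simp add: vec_eq_iff matrix_matrix_mult_def R_def S_def if_distrib if_distribR cong: if_cong)
  moreover have "rank (R ** A ** S) \<le> rank A"
    by (meson order_trans rank_mul_le_left rank_mul_le_right)
  ultimately show ?thesis
    using assms by (simp add: det_eq_0_rank)
qed

text \<open>
  The expanded form lets every later use be a polynomial identity in the entries.
\<close>

lemma minor3_eq_0:
  fixes A :: "real ^ 'n ^ 'n::finite"
  assumes "rank A \<le> 2"
  shows "A$i$p * (A$j$q * A$k$s - A$j$s * A$k$q) - A$i$q * (A$j$p * A$k$s - A$j$s * A$k$p)
       + A$i$s * (A$j$p * A$k$q - A$j$q * A$k$p) = 0"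
proof -
  have "det (\<chi> a b. A $ (if a = (1::3) then i else if a = 2 then j else k)
                        $ (if b = (1::3) then p else if b = 2 then q else s)) = 0"
    by (rule det_submatrix_eq_0) (use assms in simp)
  then show ?thesis
    by (simp add: det_3 algebra_simps)
qed

section \<open>The symbol as a perturbation of a diagonal matrix\<close>

text \<open>
  The entries of \<open>M(\<xi>)\<close>, the first-order term of the symbol in the scaling parameter. The
  case \<open>j = i\<close> of the formula is the part of \<open>p\<^sub>i\<^sub>i\<close> that remains after \<open>\<xi>\<^sub>i\<close> is removed.
\<close>

definition perturbation :: "'n::finite params \<Rightarrow> 'n \<Rightarrow> 'n \<Rightarrow> real ^ 'n \<Rightarrow> real" where
  "perturbation c i j \<xi> = (\<Sum>k\<in>UNIV - {j}. c i k j * \<xi> $ k)"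

lemma principal_symbol_scale_params:
  "principal_symbol \<xi> (scale_params t c) $ i $ j
     = (if i = j then \<xi> $ i else 0) + t * perturbation c i j \<xi>"
  by (simp add: principal_symbol_def scale_params_def perturbation_def sum_distrib_left mult.assoc)

text \<open>
  The symbol is homogeneous in \<open>\<xi>\<close>, so rank conditions can be tested on the unit sphere.
\<close>

lemma rank_principal_symbol_scaleR_le:
  fixes \<xi> :: "real ^ 'n::finite"
  shows "rank (principal_symbol (a *\<^sub>R \<xi>) c) \<le> rank (principal_symbol \<xi> c)"
proof -
  have "(mat a ** A) $ i $ j = a * A $ i $ j" for A :: "real ^ 'n ^ 'n" and i j
    by (simp add: matrix_matrix_mult_def mat_def if_distrib[of "\<lambda>u. u * _"] cong: if_cong)
  then have "principal_symbol (a *\<^sub>R \<xi>) c = mat a ** principal_symbol \<xi> c"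
    by (simp add: vec_eq_iff principal_symbol_def distrib_left sum_distrib_left mult.left_commute)
  then show ?thesis
    by (metis rank_mul_le_right)
qed

section \<open>Limits of points of low rank\<close>

context
  fixes c :: "'n::finite params" and t :: "nat \<Rightarrow> real" and X :: "nat \<Rightarrow> real ^ 'n" and x :: "real ^ 'n"
  assumes t_pos: "\<And>n. t n > 0" and t_lim: "t \<longlonglongrightarrow> 0" and X_lim: "X \<longlonglongrightarrow> x"
    and rank_le: "\<And>n. rank (principal_symbol (X n) (scale_params (t n) c)) \<le> 2"
begin

private abbreviation (input) P where "P n \<equiv> principal_symbol (X n) (scale_params (t n) c)"
private abbreviation (input) M where "M n i j \<equiv> perturbation c i j (X n)"

lemma perturbation_tendsto: "(\<lambda>n. M n i j) \<longlonglongrightarrow> perturbation c i j x"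
  unfolding perturbation_def by (intro tendsto_intros X_lim)

lemma symbol_tendsto: "(\<lambda>n. P n $ i $ j) \<longlonglongrightarrow> (if i = j then x $ i else 0)"
proof -
  have "(\<lambda>n. (if i = j then X n $ i else 0) + t n * M n i j)
          \<longlonglongrightarrow> (if i = j then x $ i else 0) + 0 * perturbation c i j x"
    by (intro tendsto_add tendsto_mult t_lim perturbation_tendsto)
      (cases "i = j"; use X_lim in \<open>simp add: tendsto_vec_nth\<close>)
  then show ?thesis
    by (simp add: principal_symbol_scale_params)
qed

lemmas limits = perturbation_tendsto symbol_tendsto

lemma offdiag: "i \<noteq> j \<Longrightarrow> P n $ i $ j = t n * M n i j"
  by (simp add: principal_symbol_scale_params)

text \<open>
  The symbols converge to \<open>diag(x)\<close>, and the vanishing of a principal minor survives the limit.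
\<close>

lemma limit_coordinates:
  assumes "distinct [i, j, k]"
  shows "x $ i * x $ j * x $ k = 0"
proof -
  let ?L = "\<lambda>i j. if i = j then x $ i else 0"
  have "(\<lambda>n. P n$i$i * (P n$j$j * P n$k$k - P n$j$k * P n$k$j)
        - P n$i$j * (P n$j$i * P n$k$k - P n$j$k * P n$k$i)
        + P n$i$k * (P n$j$i * P n$k$j - P n$j$j * P n$k$i)) 
     \<longlonglongrightarrow> ?L i i * (?L j j * ?L k k - ?L j k * ?L k j)
        - ?L i j * (?L j i * ?L k k - ?L j k * ?L k i)
        + ?L i k * (?L j i * ?L k j - ?L j j * ?L k i)"
    by (intro tendsto_intros limits)
  then show ?thesis
    using assms LIMSEQ_unique[OF _ tendsto_const] by (fastforce simp: minor3_eq_0[OF rank_le])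
qed

text \<open>
  The first row of the minor with rows \<open>i, k, l\<close> and columns \<open>j, k, l\<close> is off-diagonal and so has a
  factor \<open>t\<close>. After division by it only the term \<open>M\<^sub>i\<^sub>j x\<^sub>k x\<^sub>l\<close> survives, since the other terms
  contain an off-diagonal entry of the rows \<open>k\<close> and \<open>l\<close>.
\<close>

lemma limit_two_directions:
  assumes "distinct [i, j, k, l]"
  shows "perturbation c i j x * x $ k * x $ l = 0"
proof -
  let ?L = "\<lambda>i j. if i = j then x $ i else 0" and ?m = "\<lambda>i j. perturbation c i j x"
  let ?q = "\<lambda>n. M n i j * (P n$k$k * P n$l$l - P n$k$l * P n$l$k)
        - M n i k * (P n$k$j * P n$l$l - P n$k$l * P n$l$j)
        + M n i l * (P n$k$j * P n$l$k - P n$k$k * P n$l$j)"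
  have "t n * ?q n = 0" for n
    using minor3_eq_0[OF rank_le[of n], where i=i and j=k and k=l and p=j and q=k and s=l] assms
    by (simp add: offdiag algebra_simps)
  then have "?q n = 0" for n
    using t_pos[of n] by (metis less_irrefl mult_eq_0_iff)
  moreover have "?q \<longlonglongrightarrow> ?m i j * (?L k k * ?L l l - ?L k l * ?L l k)
        - ?m i k * (?L k j * ?L l l - ?L k l * ?L l j)
        + ?m i l * (?L k j * ?L l k - ?L k k * ?L l j)"
    by (intro tendsto_intros limits)
  ultimately show ?thesis
    using assms LIMSEQ_unique[OF _ tendsto_const] by fastforce
qed

text \<open>
  Since \<open>x\<^sub>l \<noteq> 0\<close>, the entry \<open>(l, l)\<close> serves as a pivot: the Schur complement, a \<open>3 \<times> 3\<close> matrix
  indexed by \<open>i, j, k\<close>, has rank at most one. The entries of a rank-one matrix \<open>u v\<^sup>T\<close> have equal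
  products along the two 3-cycles. This relation involves off-diagonal entries only, hence it avoids
  the diagonal entries, in which \<open>\<xi>\<^sub>i, \<xi>\<^sub>j, \<xi>\<^sub>k\<close> compete with \<open>t\<close> at an unknown rate.
\<close>

lemma limit_one_direction:
  assumes "distinct [i, j, k, l]" and "x $ l \<noteq> 0"
  shows "perturbation c i j x * perturbation c j k x * perturbation c k i x
       = perturbation c i k x * perturbation c j i x * perturbation c k j x"
proof -
  let ?m = "\<lambda>i j. perturbation c i j x"
  \<comment> \<open>\<open>R\<close> is the Schur complement multiplied by the pivot, and \<open>r\<close> is \<open>R / t\<close> off the diagonal.\<close>
  define R where "R n a b = P n $ l $ l * P n $ a $ b - P n $ a $ l * P n $ l $ b" for n a b
  define r where "r n a b = P n $ l $ l * M n a b - P n $ a $ l * M n l b" for n a b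
  \<comment> \<open>Sylvester's identity: a \<open>2 \<times> 2\<close> minor of \<open>R\<close> is the pivot times a \<open>3 \<times> 3\<close> minor.\<close>
  have R_minor: "R n a p * R n b q = R n a q * R n b p" for n a b p q
  proof -
    have "R n a p * R n b q - R n a q * R n b p = P n $ l $ l * 0"
      unfolding minor3_eq_0[OF rank_le[of n], where i=a and j=b and k=l and p=p and q=q and s=l, symmetric]
      by (simp add: R_def algebra_simps)
    then show ?thesis by simp
  qed
  \<comment> \<open>Both sides equal \<open>R\<^sub>i\<^sub>k R\<^sub>j\<^sub>j R\<^sub>k\<^sub>i\<close>.\<close>
  have R_cycle: "R n i j * R n j k * R n k i = R n i k * R n j i * R n k j" for n
    by (metis R_minor mult.assoc mult.commute)
  have R_r: "R n a b = t n * r n a b" if "a \<noteq> b" "a \<noteq> l" "b \<noteq> l" for n a b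
    using that by (simp add: R_def r_def offdiag algebra_simps)
  have "t n ^ 3 * (r n i j * r n j k * r n k i) = t n ^ 3 * (r n i k * r n j i * r n k j)" for n
  proof -
    have "R n i j = t n * r n i j" "R n j k = t n * r n j k" "R n k i = t n * r n k i"
      "R n i k = t n * r n i k" "R n j i = t n * r n j i" "R n k j = t n * r n k j"
      using R_r assms by auto
    with R_cycle[of n] show ?thesis
      by (simp only: power3_eq_cube mult_ac)
  qed
  then have r_cycle: "r n i j * r n j k * r n k i = r n i k * r n j i * r n k j" for n
    using t_pos[of n] by (metis less_irrefl mult_left_cancel power_not_zero)
  have r_lim: "(\<lambda>n. r n a b) \<longlonglongrightarrow> x $ l * ?m a b" if "a \<noteq> l" for a b
  proof -
    have "(\<lambda>n. r n a b) \<longlonglongrightarrow> (if l = l then x $ l else 0) * ?m a b - (if a = l then x $ a else 0) * ?m l b"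
      unfolding r_def by (intro tendsto_intros limits)
    with that show ?thesis by simp
  qed
  have "(\<lambda>n. r n i j * r n j k * r n k i) \<longlonglongrightarrow> (x $ l * ?m i j) * (x $ l * ?m j k) * (x $ l * ?m k i)"
    by (intro tendsto_intros r_lim) (use assms in auto)
  moreover have "(\<lambda>n. r n i j * r n j k * r n k i) \<longlonglongrightarrow> (x $ l * ?m i k) * (x $ l * ?m j i) * (x $ l * ?m k j)"
    unfolding r_cycle by (intro tendsto_intros r_lim) (use assms in auto)
  ultimately have "(x $ l * ?m i j) * (x $ l * ?m j k) * (x $ l * ?m k i)
      = (x $ l * ?m i k) * (x $ l * ?m j i) * (x $ l * ?m k j)"
    by (rule LIMSEQ_unique)
  then have "x $ l ^ 3 * (?m i j * ?m j k * ?m k i) = x $ l ^ 3 * (?m i k * ?m j i * ?m k j)"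
    by (simp add: power3_eq_cube mult_ac)
  then show ?thesis using assms by simp
qed

end

lemma degenerate_sequence:
  fixes c :: "'n::finite params"
  assumes card: "CARD('n) = 4" and "\<not> (\<exists>T>0. \<forall>t\<in>{0<..<T}. smooth_char_variety (scale_params t c))"
  obtains t X x where "\<And>n. t n > 0" "t \<longlonglongrightarrow> 0" "X \<longlonglongrightarrow> x" "x \<noteq> 0"
    "\<And>n::nat. rank (principal_symbol (X n) (scale_params (t n) c)) \<le> 2"
proof -
  have "\<exists>t \<xi>. 0 < t \<and> t < 1 / real (Suc n) \<and> \<xi> \<noteq> 0
      \<and> rank (principal_symbol \<xi> (scale_params t c)) \<le> 2" for n
  proof -
    have "(0::real) < 1 / real (Suc n)" by simp
    with assms(2) obtain t where t: "t \<in> {0<..<1 / real (Suc n)}" 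
      and "\<not> smooth_char_variety (scale_params t c)" by blast
    then show ?thesis
      using card by (auto simp: smooth_char_variety_def sing_char_variety_def)
  qed
  then obtain t \<xi> where t: "\<And>n. 0 < t n" "\<And>n. t n < 1 / real (Suc n)" and \<xi>: "\<And>n. \<xi> n \<noteq> 0"
    and rk: "\<And>n. rank (principal_symbol (\<xi> n) (scale_params (t n) c)) \<le> 2"
    by metis
  \<comment> \<open>Normalisation makes the limit nonzero.\<close>
  define X where "X n = (1 / norm (\<xi> n)) *\<^sub>R \<xi> n" for n
  have "X n \<in> sphere 0 1" for n
    using \<xi>[of n] by (simp add: X_def)
  then obtain x r where x: "x \<in> sphere 0 1" and r: "strict_mono r" and lim: "(X \<circ> r) \<longlonglongrightarrow> x"
    using compact_sphere[of "0 :: real ^ 'n" 1] unfolding compact_def by metis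
  have "t \<longlonglongrightarrow> 0"
    by (rule tendsto_sandwich[OF _ _ tendsto_const LIMSEQ_inverse_real_of_nat])
      (use t in \<open>auto intro!: always_eventually simp: less_imp_le field_simps\<close>)
  then have "(t \<circ> r) \<longlonglongrightarrow> 0"
    using r by (rule LIMSEQ_subseq_LIMSEQ)
  moreover have "rank (principal_symbol ((X \<circ> r) n) (scale_params ((t \<circ> r) n) c)) \<le> 2" for n
    using order_trans[OF rank_principal_symbol_scaleR_le rk] by (simp add: X_def)
  moreover have "(t \<circ> r) n > 0" for n
    using t by simp
  moreover have "x \<noteq> 0"
    using x by auto
  ultimately show thesis
    using that[of "t \<circ> r" "X \<circ> r" x] lim by blast
qed

section \<open>Four dimensions\<close>

lemma UNIV_4_eq_distinct:
  fixes i j k l :: 4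
  assumes "distinct [i, j, k, l]"
  shows "UNIV = {i, j, k, l}"
proof -
  have "card {i, j, k, l} = CARD(4)" using assms by simp
  then show ?thesis by (metis card_subset_eq finite subset_UNIV)
qed

lemma perturbation_4:
  fixes i j k l :: 4
  assumes "distinct [i, j, k, l]"
  shows "perturbation c i j x = c i i j * x $ i + c i k j * x $ k + c i l j * x $ l"
proof -
  have "UNIV - {j} = {i, k, l}"
    using UNIV_4_eq_distinct[OF assms] assms by auto
  with assms show ?thesis by (simp add: perturbation_def)
qed

theorem theorem3p4:
  fixes c :: "4 params"
  assumes "parameter_collection c"
    and "\<forall>i j k l. distinct [i, j, k, l] \<longrightarrow> c j i k * c i j l \<noteq> c j i l * c i j k"
    and "c 2 1 4 * c 4 1 3 * c 3 1 2 \<noteq> c 4 1 2 * c 3 1 4 * c 2 1 3"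
    and "c 4 2 1 * c 3 2 4 * c 1 2 3 \<noteq> c 1 2 4 * c 4 2 3 * c 3 2 1"
    and "c 4 3 1 * c 2 3 4 * c 1 3 2 \<noteq> c 1 3 4 * c 4 3 2 * c 2 3 1"
    and "c 2 4 1 * c 1 4 3 * c 3 4 2 \<noteq> c 1 4 2 * c 3 4 1 * c 2 4 3"
  shows "\<exists>T>0. \<forall>t\<in>{0<..<T}. smooth_char_variety (scale_params t c)"
proof (rule ccontr)
  have card4: "CARD(4) = 4" by simp
  assume "\<not> ?thesis"
  then obtain t X x where seq: "\<And>n. t n > 0" "t \<longlonglongrightarrow> 0" "X \<longlonglongrightarrow> x"
    "\<And>n::nat. rank (principal_symbol (X n) (scale_params (t n) c)) \<le> 2" and "x \<noteq> 0"
    using degenerate_sequence[of c] by (metis card4)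
  have upper_sym: "c i k j = c i j k" if "k \<noteq> j" for k j i
    using assms(1) that by (simp add: parameter_collection_def)
  have one: "x $ k = 0 \<or> x $ l = 0" if d: "distinct [i, j, k, l]" for i j k l
  proof (rule ccontr)
    assume nz: "\<not> (x $ k = 0 \<or> x $ l = 0)"
    have z: "x $ i = 0" "x $ j = 0"
      using limit_coordinates[OF seq, of i k l] limit_coordinates[OF seq, of j k l] d nz by auto
    have d': "distinct [j, i, k, l]" using d by auto
    have "c i j k * x $ k + c i j l * x $ l = 0"
      using limit_two_directions[OF seq d] perturbation_4[OF d, of c x] nz z d
        upper_sym[of k j i] upper_sym[of l j i] by auto
    moreover have "c j i k * x $ k + c j i l * x $ l = 0"
      using limit_two_directions[OF seq d'] perturbation_4[OF d', of c x] nz z d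
        upper_sym[of k i j] upper_sym[of l i j] by auto
    \<comment> \<open>Eliminating \<open>x\<^sub>l\<close> leaves the determinant of the system.\<close>
    ultimately have "(c j i k * c i j l - c j i l * c i j k) * x $ k = 0"
      by algebra
    with nz assms(2) d show False by auto
  qed
  have cycle: "c i l j * c j l k * c k l i = c i l k * c j l i * c k l j"
    if d: "distinct [i, j, k, l]" and nz: "x $ l \<noteq> 0" for i j k l
  proof -
    have z: "x $ i = 0" "x $ j = 0" "x $ k = 0"
      using one[of j k i l] one[of i k j l] one[of i j k l] d nz by auto
    have m: "perturbation c a b x = c a l b * x $ l" if "a \<noteq> b" "a \<in> {i, j, k}" "b \<in> {i, j, k}" for a b
    proof -
      have "\<exists>e\<in>{i, j, k}. distinct [a, b, e, l]"
        using that d by auto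
      then obtain e where "distinct [a, b, e, l]" "e \<in> {i, j, k}"
        by blast
      then show ?thesis
        using perturbation_4[of a b e l c x] that z by auto
    qed
    have "x $ l ^ 3 * (c i l j * c j l k * c k l i) = x $ l ^ 3 * (c i l k * c j l i * c k l j)"
    proof -
      have "perturbation c i j x = c i l j * x $ l" "perturbation c j k x = c j l k * x $ l"
        "perturbation c k i x = c k l i * x $ l" "perturbation c i k x = c i l k * x $ l"
        "perturbation c j i x = c j l i * x $ l" "perturbation c k j x = c k l j * x $ l"
        using m d by auto
      with limit_one_direction[OF seq d nz] show ?thesis
        by (simp only: power3_eq_cube mult_ac)
    qed
    with nz show ?thesis by simp
  qed
  obtain l where "x $ l \<noteq> 0"
    using \<open>x \<noteq> 0\<close> by (auto simp: vec_eq_iff)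
  moreover have "l \<in> {1, 2, 3, 4}"
    using UNIV_4_eq_distinct[of 1 2 3 4] by auto
  ultimately show False
    using cycle[of 2 4 3 1] cycle[of 4 1 3 2] cycle[of 4 1 2 3] cycle[of 2 1 3 4] assms(3-6)
    by (auto simp: mult_ac)
qed

end
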